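(* Let $P:\mathbb C^{\mathrm{op}}\to\mathbf{Pos}$ be a primary doctrine, $X$ an object of $\mathbb C$ and $\varphi\in P(X)$, and let $P_{(X,\varphi)}$ be the associated Kleisli doctrine with canonical 1-arrow $(F_X,\mathfrak f):P\to P_{(X,\varphi)}$. If $P$ is an implicational doctrine, then $P_{(X,\varphi)}$ is an implicational doctrine, and $(F_X,\mathfrak f)$ is an implicational homomorphism.
   Context: A doctrine is a functor $P:\mathbb C^{\mathrm{op}}\to\mathbf{Pos}$ with $\mathbb C$ a category with finite products and $\mathbf{Pos}$ the category of posets and monotone maps; the maps $P(f)$ are called reindexings. It is primary if every $P(A)$ has finite meets ($\wedge$, $\top$) and all reindexings preserve them. A 1-arrow (doctrine homomorphism) from $P:\mathbb C^{\mathrm{op}}\to\mathbf{Pos}$ to $R:\mathbb D^{\mathrm{op}}\to\mathbf{Pos}$ is a pair $(F,\mathfrak f)$ with $F:\mathbb C\to\mathbb D$ a finite-product-preserving functor and $\mathfrak f:P\to R\circ F^{\mathrm{op}}$ natural. A doctrine $P$ is implicational if every $P(A)$ is a cartesian closed poset (finite meets and an implication $\to$ with $a\wedge b\le c\iff a\le b\to c$) and all reindexings preserve $\wedge,\top,\to$. A homomorphism $(F,\mathfrak f)$ between implicational doctrines is implicational if each $\mathfrak f_A$ preserves $\wedge,\top,\to$. Kleisli doctrine (the Kleisli object of the comonad on $P$ given by $X\times-$ and $\alpha\mapsto P(\mathrm{pr}_1)(\varphi)\wedge P(\mathrm{pr}_2)(\alpha)$). The category $\mathbb C_X$ has the same objects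 as $\mathbb C$; an arrow $g:A\rightsquigarrow B$ in $\mathbb C_X$ is a $\mathbb C$-arrow $g:X\times A\to B$; the identity of $A$ is $\mathrm{pr}_2:X\times A\to A$; the composite of $g:A\rightsquigarrow B$ and $h:B\rightsquigarrow C$ is $h\langle\mathrm{pr}_1,g\rangle$. It has finite products, given on objects by those of $\mathbb C$. The doctrine $P_{(X,\varphi)}:\mathbb C_X^{\mathrm{op}}\to\mathbf{Pos}$ has $P_{(X,\varphi)}(A)=\{\alpha\in P(X\times A)\mid\alpha\le P(\mathrm{pr}_1)(\varphi)\}$ with the order of $P(X\times A)$, and reindexing along $g:A\rightsquigarrow B$ is the restriction of $P(\langle\mathrm{pr}_1,g\rangle)$. The 1-arrow $(F_X,\mathfrak f):P\to P_{(X,\varphi)}$: $F_X:\mathbb C\to\mathbb C_X$ is the identity on objects and sends $f:A\to B$ to $f\,\mathrm{pr}_2:A\rightsquigarrow B$; $\mathfrak f_A(\alpha)=P(\mathrm{pr}_1)(\varphi)\wedge P(\mathrm{pr}_2)(\alpha)$, for $\mathrm{pr}_1,\mathrm{pr}_2$ the projections from $X\times A$. *)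

theory Defs
  imports "HOL-Algebra.Lattice"
begin

section \<open>Categories with finite products\<close>

text \<open>
  Hom-sets are indexed families \<open>Hom C A B\<close> which need not be disjoint; composition and
  reindexing therefore carry the objects as arguments. This matters for the Kleisli category
  below: a raw arrow \<open>X \<times> A \<rightarrow> B\<close> need not determine the object \<open>A\<close>.
  \<open>Comp C A B D g f\<close> is \<open>g \<circ> f\<close> for \<open>f : A \<rightarrow> B\<close> and \<open>g : B \<rightarrow> D\<close>.
  Finite products are a terminal object \<open>One C\<close> and binary products, with a choice.
\<close>

record ('o, 'a) fp_cat_data =
  Ob :: "'o set"
  Hom :: "'o \<Rightarrow> 'o \<Rightarrow> 'a set"
  Ident :: "'o \<Rightarrow> 'a"
  Comp :: "'o \<Rightarrow> 'o \<Rightarrow> 'o \<Rightarrow> 'a \<Rightarrow> 'a \<Rightarrow> 'a"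
  One :: "'o"
  Prod :: "'o \<Rightarrow> 'o \<Rightarrow> 'o"
  Pr1 :: "'o \<Rightarrow> 'o \<Rightarrow> 'a"
  Pr2 :: "'o \<Rightarrow> 'o \<Rightarrow> 'a"

locale category =
  fixes C :: "('o, 'a) fp_cat_data"
  assumes Ident_in_Hom: "A \<in> Ob C \<Longrightarrow> Ident C A \<in> Hom C A A"
    and Comp_in_Hom:
      "\<lbrakk>A \<in> Ob C; B \<in> Ob C; D \<in> Ob C; f \<in> Hom C A B; g \<in> Hom C B D\<rbrakk>
        \<Longrightarrow> Comp C A B D g f \<in> Hom C A D"
    and Comp_Ident_right:
      "\<lbrakk>A \<in> Ob C; B \<in> Ob C; f \<in> Hom C A B\<rbrakk> \<Longrightarrow> Comp C A A B f (Ident C A) = f"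
    and Comp_Ident_left:
      "\<lbrakk>A \<in> Ob C; B \<in> Ob C; f \<in> Hom C A B\<rbrakk> \<Longrightarrow> Comp C A B B (Ident C B) f = f"
    and Comp_assoc:
      "\<lbrakk>A \<in> Ob C; B \<in> Ob C; D \<in> Ob C; E \<in> Ob C;
        f \<in> Hom C A B; g \<in> Hom C B D; h \<in> Hom C D E\<rbrakk>
        \<Longrightarrow> Comp C A D E h (Comp C A B D g f) = Comp C A B E (Comp C B D E h g) f"

definition is_terminal :: "('o, 'a) fp_cat_data \<Rightarrow> 'o \<Rightarrow> bool" where
  "is_terminal C T \<longleftrightarrow> T \<in> Ob C \<and> (\<forall>A\<in>Ob C. \<exists>!t. t \<in> Hom C A T)"

definition is_product ::
  "('o, 'a) fp_cat_data \<Rightarrow> 'o \<Rightarrow> 'o \<Rightarrow> 'o \<Rightarrow> 'a \<Rightarrow> 'a \<Rightarrow> bool" where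
  "is_product C A B Q p q \<longleftrightarrow>
     Q \<in> Ob C \<and> p \<in> Hom C Q A \<and> q \<in> Hom C Q B \<and>
     (\<forall>Z\<in>Ob C. \<forall>f\<in>Hom C Z A. \<forall>g\<in>Hom C Z B.
        \<exists>!h. h \<in> Hom C Z Q \<and> Comp C Z Q A p h = f \<and> Comp C Z Q B q h = g)"

locale fp_category = category +
  assumes One_terminal: "is_terminal C (One C)"
    and Prod_product:
      "\<lbrakk>A \<in> Ob C; B \<in> Ob C\<rbrakk> \<Longrightarrow> is_product C A B (Prod C A B) (Pr1 C A B) (Pr2 C A B)"

text \<open>\<open>tuple C Z A B f g\<close> is \<open>\<langle>f, g\<rangle> : Z \<rightarrow> A \<times> B\<close>.\<close>

definition tuple :: "('o, 'a) fp_cat_data \<Rightarrow> 'o \<Rightarrow> 'o \<Rightarrow> 'o \<Rightarrow> 'a \<Rightarrow> 'a \<Rightarrow> 'a" where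
  "tuple C Z A B f g =
     (THE h. h \<in> Hom C Z (Prod C A B) \<and>
        Comp C Z (Prod C A B) A (Pr1 C A B) h = f \<and>
        Comp C Z (Prod C A B) B (Pr2 C A B) h = g)"

text \<open>Preservation of products is preservation of all product diagrams, not of the choice.\<close>

locale fp_functor = dom: fp_category C + cod: fp_category D
  for C :: "('o, 'a) fp_cat_data" and D :: "('u, 'b) fp_cat_data" +
  fixes F0 :: "'o \<Rightarrow> 'u" and F1 :: "'o \<Rightarrow> 'o \<Rightarrow> 'a \<Rightarrow> 'b"
  assumes F0_in_Ob: "A \<in> Ob C \<Longrightarrow> F0 A \<in> Ob D"
    and F1_in_Hom:
      "\<lbrakk>A \<in> Ob C; B \<in> Ob C; f \<in> Hom C A B\<rbrakk> \<Longrightarrow> F1 A B f \<in> Hom D (F0 A) (F0 B)"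
    and F1_Ident: "A \<in> Ob C \<Longrightarrow> F1 A A (Ident C A) = Ident D (F0 A)"
    and F1_Comp:
      "\<lbrakk>A \<in> Ob C; B \<in> Ob C; E \<in> Ob C; f \<in> Hom C A B; g \<in> Hom C B E\<rbrakk>
        \<Longrightarrow> F1 A E (Comp C A B E g f) = Comp D (F0 A) (F0 B) (F0 E) (F1 B E g) (F1 A B f)"
    and preserves_terminal: "is_terminal C T \<Longrightarrow> is_terminal D (F0 T)"
    and preserves_product:
      "\<lbrakk>A \<in> Ob C; B \<in> Ob C; is_product C A B Q p q\<rbrakk>
        \<Longrightarrow> is_product D (F0 A) (F0 B) (F0 Q) (F1 Q A p) (F1 Q B q)"

section \<open>Cartesian closed posets\<close>

locale finite_meet_poset = lower_semilattice + weak_partial_order_top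

definition imp :: "'p gorder \<Rightarrow> 'p \<Rightarrow> 'p \<Rightarrow> 'p" where
  "imp L b c =
     (THE i. i \<in> carrier L \<and> (\<forall>a\<in>carrier L. a \<sqinter>\<^bsub>L\<^esub> b \<sqsubseteq>\<^bsub>L\<^esub> c \<longleftrightarrow> a \<sqsubseteq>\<^bsub>L\<^esub> i))"

locale cartesian_closed_poset = finite_meet_poset L for L :: "'p gorder" (structure) +
  assumes imp_exists:
    "\<lbrakk>b \<in> carrier L; c \<in> carrier L\<rbrakk>
      \<Longrightarrow> \<exists>i\<in>carrier L. \<forall>a\<in>carrier L. a \<sqinter> b \<sqsubseteq> c \<longleftrightarrow> a \<sqsubseteq> i"

definition preserves_meets :: "'p gorder \<Rightarrow> 'q gorder \<Rightarrow> ('p \<Rightarrow> 'q) \<Rightarrow> bool" where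
  "preserves_meets L M h \<longleftrightarrow>
     (\<forall>a\<in>carrier L. \<forall>b\<in>carrier L. h (a \<sqinter>\<^bsub>L\<^esub> b) = h a \<sqinter>\<^bsub>M\<^esub> h b) \<and> h \<top>\<^bsub>L\<^esub> = \<top>\<^bsub>M\<^esub>"

definition preserves_imp :: "'p gorder \<Rightarrow> 'q gorder \<Rightarrow> ('p \<Rightarrow> 'q) \<Rightarrow> bool" where
  "preserves_imp L M h \<longleftrightarrow>
     (\<forall>a\<in>carrier L. \<forall>b\<in>carrier L. h (imp L a b) = imp M (h a) (h b))"

section \<open>Doctrines\<close>

text \<open>
  \<open>fib P A\<close> is the poset \<open>P(A)\<close>, and \<open>reindex P A B f\<close> is \<open>P(f) : P(B) \<rightarrow> P(A)\<close> for \<open>f : A \<rightarrow> B\<close>.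
\<close>

record ('o, 'a, 'p) doctrine_data =
  base :: "('o, 'a) fp_cat_data"
  fib :: "'o \<Rightarrow> 'p gorder"
  reindex :: "'o \<Rightarrow> 'o \<Rightarrow> 'a \<Rightarrow> 'p \<Rightarrow> 'p"

locale doctrine =
  fixes P :: "('o, 'a, 'p) doctrine_data"
  assumes base_fp_category: "fp_category (base P)"
    and fib_partial_order: "A \<in> Ob (base P) \<Longrightarrow> partial_order (fib P A)"
    and reindex_closed:
      "\<lbrakk>A \<in> Ob (base P); B \<in> Ob (base P); f \<in> Hom (base P) A B\<rbrakk>
        \<Longrightarrow> reindex P A B f \<in> carrier (fib P B) \<rightarrow> carrier (fib P A)"
    and reindex_isotone:
      "\<lbrakk>A \<in> Ob (base P); B \<in> Ob (base P); f \<in> Hom (base P) A B\<rbrakk>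
        \<Longrightarrow> isotone (fib P B) (fib P A) (reindex P A B f)"
    and reindex_Ident:
      "\<lbrakk>A \<in> Ob (base P); \<alpha> \<in> carrier (fib P A)\<rbrakk>
        \<Longrightarrow> reindex P A A (Ident (base P) A) \<alpha> = \<alpha>"
    and reindex_Comp:
      "\<lbrakk>A \<in> Ob (base P); B \<in> Ob (base P); D \<in> Ob (base P);
        f \<in> Hom (base P) A B; g \<in> Hom (base P) B D; \<alpha> \<in> carrier (fib P D)\<rbrakk>
        \<Longrightarrow> reindex P A D (Comp (base P) A B D g f) \<alpha> = reindex P A B f (reindex P B D g \<alpha>)"

locale primary_doctrine = doctrine +
  assumes fib_finite_meets: "A \<in> Ob (base P) \<Longrightarrow> finite_meet_poset (fib P A)"
    and reindex_meets:
      "\<lbrakk>A \<in> Ob (base P); B \<in> Ob (base P); f \<in> Hom (base P) A B\<rbrakk>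
        \<Longrightarrow> preserves_meets (fib P B) (fib P A) (reindex P A B f)"

locale implicational_doctrine = primary_doctrine +
  assumes fib_cartesian_closed: "A \<in> Ob (base P) \<Longrightarrow> cartesian_closed_poset (fib P A)"
    and reindex_imp:
      "\<lbrakk>A \<in> Ob (base P); B \<in> Ob (base P); f \<in> Hom (base P) A B\<rbrakk>
        \<Longrightarrow> preserves_imp (fib P B) (fib P A) (reindex P A B f)"

record ('o, 'a, 'p, 'u, 'b, 'q) doctrine_map =
  on_ob :: "'o \<Rightarrow> 'u"
  on_arr :: "'o \<Rightarrow> 'o \<Rightarrow> 'a \<Rightarrow> 'b"
  on_fib :: "'o \<Rightarrow> 'p \<Rightarrow> 'q"

locale doctrine_hom = dom: doctrine P + cod: doctrine R
  for P :: "('o, 'a, 'p) doctrine_data" and R :: "('u, 'b, 'q) doctrine_data" +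
  fixes H :: "('o, 'a, 'p, 'u, 'b, 'q) doctrine_map"
  assumes functor_part: "fp_functor (base P) (base R) (on_ob H) (on_arr H)"
    and on_fib_closed:
      "A \<in> Ob (base P) \<Longrightarrow> on_fib H A \<in> carrier (fib P A) \<rightarrow> carrier (fib R (on_ob H A))"
    and on_fib_isotone:
      "A \<in> Ob (base P) \<Longrightarrow> isotone (fib P A) (fib R (on_ob H A)) (on_fib H A)"
    and on_fib_natural:
      "\<lbrakk>A \<in> Ob (base P); B \<in> Ob (base P); f \<in> Hom (base P) A B; \<beta> \<in> carrier (fib P B)\<rbrakk>
        \<Longrightarrow> on_fib H A (reindex P A B f \<beta>) =
            reindex R (on_ob H A) (on_ob H B) (on_arr H A B f) (on_fib H B \<beta>)"

locale implicational_hom =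
  doctrine_hom P R H + dom: implicational_doctrine P + cod: implicational_doctrine R
  for P :: "('o, 'a, 'p) doctrine_data" and R :: "('u, 'b, 'q) doctrine_data"
    and H :: "('o, 'a, 'p, 'u, 'b, 'q) doctrine_map" +
  assumes on_fib_meets:
      "A \<in> Ob (base P) \<Longrightarrow> preserves_meets (fib P A) (fib R (on_ob H A)) (on_fib H A)"
    and on_fib_imp:
      "A \<in> Ob (base P) \<Longrightarrow> preserves_imp (fib P A) (fib R (on_ob H A)) (on_fib H A)"

section \<open>The Kleisli doctrine\<close>

text \<open>
  The projections of the Kleisli category are the images \<open>pr\<^sub>i \<circ> pr\<^sub>2\<close> of those of \<open>C\<close> under
  the canonical functor.
\<close>

definition kleisli_cat :: "('o, 'a) fp_cat_data \<Rightarrow> 'o \<Rightarrow> ('o, 'a) fp_cat_data" where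
  "kleisli_cat C X =
     \<lparr> Ob = Ob C,
       Hom = (\<lambda>A B. Hom C (Prod C X A) B),
       Ident = (\<lambda>A. Pr2 C X A),
       Comp = (\<lambda>A B D h g.
         Comp C (Prod C X A) (Prod C X B) D h (tuple C (Prod C X A) X B (Pr1 C X A) g)),
       One = One C,
       Prod = Prod C,
       Pr1 = (\<lambda>A B. Comp C (Prod C X (Prod C A B)) (Prod C A B) A (Pr1 C A B) (Pr2 C X (Prod C A B))),
       Pr2 = (\<lambda>A B. Comp C (Prod C X (Prod C A B)) (Prod C A B) B (Pr2 C A B) (Pr2 C X (Prod C A B))) \<rparr>"

text \<open>
  Reindexing is given by the formula on all of \<open>P(X \<times> B)\<close>; only its restriction to the fibre is
  relevant.
\<close>

definition kleisli_doctrine ::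
  "('o, 'a, 'p) doctrine_data \<Rightarrow> 'o \<Rightarrow> 'p \<Rightarrow> ('o, 'a, 'p) doctrine_data" where
  "kleisli_doctrine P X \<phi> =
     (let C = base P in
      \<lparr> base = kleisli_cat C X,
        fib = (\<lambda>A. (fib P (Prod C X A))
          \<lparr> carrier := {\<alpha> \<in> carrier (fib P (Prod C X A)).
              \<alpha> \<sqsubseteq>\<^bsub>fib P (Prod C X A)\<^esub> reindex P (Prod C X A) X (Pr1 C X A) \<phi>} \<rparr>),
        reindex = (\<lambda>A B g. reindex P (Prod C X A) (Prod C X B)
          (tuple C (Prod C X A) X B (Pr1 C X A) g)) \<rparr>)"

definition kleisli_map ::
  "('o, 'a, 'p) doctrine_data \<Rightarrow> 'o \<Rightarrow> 'p \<Rightarrow> ('o, 'a, 'p, 'o, 'a, 'p) doctrine_map" where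
  "kleisli_map P X \<phi> =
     (let C = base P in
      \<lparr> on_ob = (\<lambda>A. A),
        on_arr = (\<lambda>A B f. Comp C (Prod C X A) A B f (Pr2 C X A)),
        on_fib = (\<lambda>A \<alpha>.
          reindex P (Prod C X A) X (Pr1 C X A) \<phi> \<sqinter>\<^bsub>fib P (Prod C X A)\<^esub>
          reindex P (Prod C X A) A (Pr2 C X A) \<alpha>) \<rparr>)"

end

theory Submission
  imports Defs
begin

text \<open>
  The fibre of \<open>P_(X,\<phi>)\<close> over \<open>A\<close> is the down-set of \<open>u = P(pr\<^sub>1)(\<phi>)\<close> in \<open>P(X \<times> A)\<close>. A down-set
  of a cartesian closed poset is cartesian closed, with the same binary meets, top \<open>u\<close> and
  implication \<open>u \<and> (a \<rightarrow> b)\<close>, and \<open>u \<and> -\<close> is an implicational map onto it since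
  \<open>u \<and> (a \<rightarrow> b) = u \<and> ((u \<and> a) \<rightarrow> (u \<and> b))\<close>. Since \<open>pr\<^sub>1 \<langle>pr\<^sub>1, g\<rangle> = pr\<^sub>1\<close>, reindexing along
  \<open>\<langle>pr\<^sub>1, g\<rangle>\<close> maps the bound \<open>u\<close> over \<open>B\<close> to the bound \<open>u\<close> over \<open>A\<close>, so it restricts to the
  down-sets and still preserves all the structure.
\<close>

section \<open>Down-sets of cartesian closed posets\<close>

text \<open>The carrier update is the one in the fibres of \<open>kleisli_doctrine\<close>, so each
  fibre there is literally a \<open>downset\<close> of a fibre of \<open>P\<close>.\<close>

definition downset :: "('p, 'r) gorder_scheme \<Rightarrow> 'p \<Rightarrow> ('p, 'r) gorder_scheme" where
  "downset L u = L\<lparr>carrier := {a \<in> carrier L. a \<sqsubseteq>\<^bsub>L\<^esub> u}\<rparr>"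

lemma downset_simps [simp]:
  "carrier (downset L u) = {a \<in> carrier L. a \<sqsubseteq>\<^bsub>L\<^esub> u}"
  "le (downset L u) = le L"
  "eq (downset L u) = eq L"
  by (simp_all add: downset_def)

section \<open>Finite meets in a down-set\<close>

context finite_meet_poset
begin

text \<open>By antisymmetry the universal property determines a meet. This is the tool for
  identifying meets taken in different carriers.\<close>

lemma meet_eqI:
  assumes "x \<in> carrier L" "y \<in> carrier L" "m \<in> carrier L" "m \<sqsubseteq> x" "m \<sqsubseteq> y"
    and "\<And>z. \<lbrakk>z \<in> carrier L; z \<sqsubseteq> x; z \<sqsubseteq> y\<rbrakk> \<Longrightarrow> z \<sqsubseteq> m"
  shows "x \<sqinter> y = m"
  using assms by (meson le_antisym meet_closed meet_le meet_left meet_right)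

lemma top_eqI:
  assumes "t \<in> carrier L" "\<And>x. x \<in> carrier L \<Longrightarrow> x \<sqsubseteq> t"
  shows "\<top> = t"
  using assms by (intro le_antisym) auto

lemma le_meet_iff:
  assumes "x \<in> carrier L" "y \<in> carrier L" "z \<in> carrier L"
  shows "z \<sqsubseteq> x \<sqinter> y \<longleftrightarrow> z \<sqsubseteq> x \<and> z \<sqsubseteq> y"
  using assms by (meson le_trans meet_closed meet_le meet_left meet_right)

lemma
  assumes "x \<in> carrier L" "y \<in> carrier L" "z \<in> carrier L"
  shows meet_left_le: "x \<sqsubseteq> z \<Longrightarrow> x \<sqinter> y \<sqsubseteq> z"
    and meet_right_le: "y \<sqsubseteq> z \<Longrightarrow> x \<sqinter> y \<sqsubseteq> z"
  using assms by (meson le_trans meet_closed meet_left meet_right)+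

lemma downset_partial_order: "partial_order (downset L u)"
  by unfold_locales (auto simp: eq_is_equal intro: le_antisym le_trans)

lemma downset_finite_meet_poset:
  assumes "u \<in> carrier L"
  shows "finite_meet_poset (downset L u)"
proof -
  interpret D: partial_order "downset L u" by (rule downset_partial_order)
  show ?thesis
  proof
    fix x y assume "x \<in> carrier (downset L u)" "y \<in> carrier (downset L u)"
    then have xy: "x \<in> carrier L" "y \<in> carrier L" "x \<sqsubseteq> u" "y \<sqsubseteq> u" by auto
    then have "x \<sqinter> y \<sqsubseteq> u"
      using assms by (simp add: meet_left_le)
    then have "greatest (downset L u) (x \<sqinter> y) (Lower (downset L u) {x, y})"
      using xy by (auto simp: greatest_def Lower_def le_meet_iff intro: meet_left meet_right)
    then show "\<exists>s. greatest (downset L u) s (Lower (downset L u) {x, y})" ..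
  next
    show "\<exists>x. greatest (downset L u) x (carrier (downset L u))"
      using assms by (intro exI[of _ u]) (auto simp: greatest_def)
  qed
qed

text \<open>The meet of \<open>L\<close> already lies below \<open>u\<close>, and it dominates every
  common lower bound, in particular those in the down-set.\<close>

lemma downset_meet:
  assumes u: "u \<in> carrier L" and x: "x \<in> carrier L" "x \<sqsubseteq> u" and y: "y \<in> carrier L" "y \<sqsubseteq> u"
  shows "x \<sqinter>\<^bsub>downset L u\<^esub> y = x \<sqinter> y"
proof -
  interpret D: finite_meet_poset "downset L u" by (rule downset_finite_meet_poset[OF u])
  have "x \<sqinter> y \<sqsubseteq> u"
    using u x y by (simp add: meet_left_le)
  then show ?thesis
    using x y by (intro D.meet_eqI) (auto simp: le_meet_iff intro: meet_left meet_right)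
qed

lemma downset_top:
  assumes u: "u \<in> carrier L"
  shows "\<top>\<^bsub>downset L u\<^esub> = u"
proof -
  interpret D: finite_meet_poset "downset L u" by (rule downset_finite_meet_poset[OF u])
  show ?thesis
    using u by (intro D.top_eqI) auto
qed

end

text \<open>The two copies of \<open>u\<close> on the right are absorbed, and \<open>\<top>\<close>
  goes to \<open>u\<close>, the top of the down-set. The order is a plain \<open>gorder\<close> here
  because \<open>preserves_meets\<close> asks for one, while \<open>finite_meet_poset\<close> allows
  extended records.\<close>

lemma meet_preserves_meets:
  fixes L :: "'p gorder" (structure)
  assumes L: "finite_meet_poset L" and u: "u \<in> carrier L"
  shows "preserves_meets L (downset L u) (\<lambda>a. u \<sqinter> a)"
  unfolding preserves_meets_def
proof (intro conjI ballI)
  interpret finite_meet_poset L by (rule L)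
  fix a b assume ab: "a \<in> carrier L" "b \<in> carrier L"
  have "u \<sqinter> (a \<sqinter> b) = (u \<sqinter> a) \<sqinter> (u \<sqinter> b)"
    using u ab by (intro le_antisym) (simp_all add: le_meet_iff meet_left_le meet_right_le)
  also have "\<dots> = (u \<sqinter> a) \<sqinter>\<^bsub>downset L u\<^esub> (u \<sqinter> b)"
    using u ab by (simp add: downset_meet meet_left)
  finally show "u \<sqinter> (a \<sqinter> b) = (u \<sqinter> a) \<sqinter>\<^bsub>downset L u\<^esub> (u \<sqinter> b)" .
next
  interpret finite_meet_poset L by (rule L)
  show "u \<sqinter> \<top> = \<top>\<^bsub>downset L u\<^esub>"
    using u by (simp add: downset_top, intro meet_eqI) auto
qed

section \<open>Implication in a down-set\<close>

context cartesian_closed_poset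
begin

text \<open>Two elements with the same elements below them coincide: testing each against itself
  gives both inequalities. Existence is in the locale, so the description in \<open>imp\<close> is
  thereby well defined.\<close>

lemma imp_unique:
  assumes "b \<in> carrier L" "c \<in> carrier L"
    and "i \<in> carrier L" "\<And>a. a \<in> carrier L \<Longrightarrow> a \<sqinter> b \<sqsubseteq> c \<longleftrightarrow> a \<sqsubseteq> i"
  shows "imp L b c = i"
  unfolding imp_def
proof (rule the_equality)
  fix j assume "j \<in> carrier L \<and> (\<forall>a\<in>carrier L. a \<sqinter> b \<sqsubseteq> c \<longleftrightarrow> a \<sqsubseteq> j)"
  then show "j = i"
    using assms by (metis le_antisym le_refl)
qed (use assms in blast)

lemma
  assumes "b \<in> carrier L" "c \<in> carrier L"
  shows imp_closed: "imp L b c \<in> carrier L"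
    and le_imp_iff: "a \<in> carrier L \<Longrightarrow> a \<sqsubseteq> imp L b c \<longleftrightarrow> a \<sqinter> b \<sqsubseteq> c"
  using imp_exists[OF assms] imp_unique[OF assms] by metis+

text \<open>For \<open>a\<close> below \<open>u\<close>, lying below
  \<open>u \<sqinter> imp L b c\<close> amounts to lying below \<open>imp L b c\<close>, which is
  the adjunction of \<open>L\<close>.\<close>

lemma
  assumes u: "u \<in> carrier L" and b: "b \<in> carrier L" "b \<sqsubseteq> u" and c: "c \<in> carrier L" "c \<sqsubseteq> u"
  shows downset_imp_closed: "u \<sqinter> imp L b c \<in> carrier (downset L u)"
    and downset_imp_adjunction:
      "a \<in> carrier (downset L u) \<Longrightarrow>
        a \<sqinter>\<^bsub>downset L u\<^esub> b \<sqsubseteq>\<^bsub>downset L u\<^esub> c \<longleftrightarrow> a \<sqsubseteq>\<^bsub>downset L u\<^esub> u \<sqinter> imp L b c"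
  using assms by (auto simp: imp_closed meet_left downset_meet le_meet_iff le_imp_iff)

lemma downset_cartesian_closed_poset:
  assumes u: "u \<in> carrier L"
  shows "cartesian_closed_poset (downset L u)"
proof -
  interpret D: finite_meet_poset "downset L u" by (rule downset_finite_meet_poset[OF u])
  show ?thesis
  proof
    fix b c assume "b \<in> carrier (downset L u)" "c \<in> carrier (downset L u)"
    then show "\<exists>i\<in>carrier (downset L u). \<forall>a\<in>carrier (downset L u).
        a \<sqinter>\<^bsub>downset L u\<^esub> b \<sqsubseteq>\<^bsub>downset L u\<^esub> c \<longleftrightarrow> a \<sqsubseteq>\<^bsub>downset L u\<^esub> i"
      using downset_imp_closed[OF u, of b c] downset_imp_adjunction[OF u, of b c]
      by (intro bexI[of _ "u \<sqinter> imp L b c"] ballI) simp_all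
  qed
qed

lemma downset_imp:
  assumes u: "u \<in> carrier L" and b: "b \<in> carrier L" "b \<sqsubseteq> u" and c: "c \<in> carrier L" "c \<sqsubseteq> u"
  shows "imp (downset L u) b c = u \<sqinter> imp L b c"
proof -
  interpret D: cartesian_closed_poset "downset L u"
    by (rule downset_cartesian_closed_poset[OF u])
  show ?thesis
    using b c downset_imp_closed[OF assms] downset_imp_adjunction[OF assms]
    by (intro D.imp_unique) auto
qed

text \<open>If \<open>a\<close> is below \<open>u\<close>, then
  \<open>a \<sqinter> (u \<sqinter> b) = a \<sqinter> b\<close>, and this meet is below
  \<open>u\<close> anyway. So in the down-set the adjunction for \<open>u \<sqinter> b\<close> and
  \<open>u \<sqinter> c\<close> becomes that of \<open>L\<close> for \<open>b\<close> and
  \<open>c\<close>, even when these do not lie below \<open>u\<close>.\<close>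

lemma meet_preserves_imp:
  assumes u: "u \<in> carrier L"
  shows "preserves_imp L (downset L u) (\<lambda>a. u \<sqinter> a)"
  unfolding preserves_imp_def
proof (intro ballI)
  interpret D: cartesian_closed_poset "downset L u"
    by (rule downset_cartesian_closed_poset[OF u])
  fix b c assume b: "b \<in> carrier L" and c: "c \<in> carrier L"
  have "imp (downset L u) (u \<sqinter> b) (u \<sqinter> c) = u \<sqinter> imp L b c"
  proof (rule D.imp_unique)
    fix a assume "a \<in> carrier (downset L u)"
    then have a: "a \<in> carrier L" "a \<sqsubseteq> u" by auto
    have "a \<sqinter> (u \<sqinter> b) = (u \<sqinter> a) \<sqinter> b"
      using u a b weak_meet_assoc[of a u b] by (simp add: eq_is_equal meet_comm[of L a])
    also have "u \<sqinter> a = a"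
      using u a by (intro meet_eqI) auto
    finally have "a \<sqinter> (u \<sqinter> b) = a \<sqinter> b" .
    moreover have "a \<sqinter> b \<sqsubseteq> u"
      using u a b by (simp add: meet_left_le)
    ultimately show "a \<sqinter>\<^bsub>downset L u\<^esub> (u \<sqinter> b) \<sqsubseteq>\<^bsub>downset L u\<^esub> u \<sqinter> c \<longleftrightarrow>
        a \<sqsubseteq>\<^bsub>downset L u\<^esub> u \<sqinter> imp L b c"
      using u a b c
      by (simp add: downset_meet meet_left le_meet_iff imp_closed le_imp_iff)
  qed (use u b c in \<open>auto simp: meet_left imp_closed\<close>)
  then show "u \<sqinter> imp L b c = imp (downset L u) (u \<sqinter> b) (u \<sqinter> c)" ..
qed

end

section \<open>Restriction of structure-preserving maps to down-sets\<close>

lemma isotone_downset: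
  assumes "isotone L M h" "finite_meet_poset L" "finite_meet_poset M"
  shows "isotone (downset L u) (downset M v) h"
  using assms
  \<comment> \<open>\<open>isotone\<close> also asserts that source and target are weak partial
    orders; the destruction rules supply this for the two down-sets.\<close>
  by (auto simp: isotone_def
      dest!: finite_meet_poset.downset_partial_order partial_order.axioms(1))

text \<open>Monotonicity turns \<open>a \<sqsubseteq> u\<close> into
  \<open>h a \<sqsubseteq> h u = v\<close>. The same equation \<open>h u = v\<close> gives
  preservation of tops and of the factor \<open>u\<close> in implications below.\<close>

lemma downset_closed:
  assumes "isotone L M h" "h \<in> carrier L \<rightarrow> carrier M" "u \<in> carrier L" "h u = v"
  shows "h \<in> carrier (downset L u) \<rightarrow> carrier (downset M v)"
  using assms by (auto simp: isotone_def)

lemma preserves_meets_downset: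
  assumes L: "finite_meet_poset L" and M: "finite_meet_poset M"
    and h: "isotone L M h" "h \<in> carrier L \<rightarrow> carrier M" "preserves_meets L M h"
    and u: "u \<in> carrier L" "h u = v"
  shows "preserves_meets (downset L u) (downset M v) h"
proof -
  have v: "v \<in> carrier M" using h u by auto
  show ?thesis
    unfolding preserves_meets_def
  proof (intro conjI ballI)
    fix a b assume ab: "a \<in> carrier (downset L u)" "b \<in> carrier (downset L u)"
    moreover from this have "h a \<in> carrier (downset M v)" "h b \<in> carrier (downset M v)"
      using downset_closed[OF h(1,2) u] by auto
    ultimately show "h (a \<sqinter>\<^bsub>downset L u\<^esub> b) = h a \<sqinter>\<^bsub>downset M v\<^esub> h b"
      using h(3) u v finite_meet_poset.downset_meet[OF L] finite_meet_poset.downset_meet[OF M]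
      by (simp add: preserves_meets_def)
  qed (use u v in \<open>simp add: finite_meet_poset.downset_top[OF L] finite_meet_poset.downset_top[OF M]\<close>)
qed

text \<open>By \<open>downset_imp\<close> the left side is \<open>h\<close> applied to the meet of
  \<open>u\<close> with the implication of \<open>L\<close>; \<open>h\<close> preserves this meet
  and this implication, and sends \<open>u\<close> to \<open>v\<close>.\<close>

lemma preserves_imp_downset:
  assumes L: "cartesian_closed_poset L" and M: "cartesian_closed_poset M"
    and h: "isotone L M h" "h \<in> carrier L \<rightarrow> carrier M"
      "preserves_meets L M h" "preserves_imp L M h"
    and u: "u \<in> carrier L" "h u = v"
  shows "preserves_imp (downset L u) (downset M v) h"
  unfolding preserves_imp_def
proof (intro ballI)
  have v: "v \<in> carrier M" using h u by auto
  fix a b assume ab: "a \<in> carrier (downset L u)" "b \<in> carrier (downset L u)"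
  moreover from this have "h a \<in> carrier (downset M v)" "h b \<in> carrier (downset M v)"
    using downset_closed[OF h(1,2) u] by auto
  ultimately show "h (imp (downset L u) a b) = imp (downset M v) (h a) (h b)"
    using h(3,4) u v
    by (simp add: preserves_meets_def preserves_imp_def cartesian_closed_poset.imp_closed[OF L]
        cartesian_closed_poset.downset_imp[OF L] cartesian_closed_poset.downset_imp[OF M])
qed

lemma preserves_meets_compose:
  assumes "preserves_meets L M h" "preserves_meets M N k" "h \<in> carrier L \<rightarrow> carrier M"
  shows "preserves_meets L N (\<lambda>a. k (h a))"
  using assms by (auto simp: preserves_meets_def Pi_iff)

lemma preserves_imp_compose:
  assumes "preserves_imp L M h" "preserves_imp M N k" "h \<in> carrier L \<rightarrow> carrier M"
  shows "preserves_imp L N (\<lambda>a. k (h a))"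
  using assms by (auto simp: preserves_imp_def Pi_iff)

section \<open>The Kleisli category\<close>

context fp_category
begin

lemma
  assumes "A \<in> Ob C" "B \<in> Ob C"
  shows Prod_in_Ob: "Prod C A B \<in> Ob C"
    and Pr1_in_Hom: "Pr1 C A B \<in> Hom C (Prod C A B) A"
    and Pr2_in_Hom: "Pr2 C A B \<in> Hom C (Prod C A B) B"
  using Prod_product[OF assms] by (auto simp: is_product_def)

lemma tuple_properties:
  assumes "Z \<in> Ob C" "A \<in> Ob C" "B \<in> Ob C" "f \<in> Hom C Z A" "g \<in> Hom C Z B"
  shows "tuple C Z A B f g \<in> Hom C Z (Prod C A B) \<and>
    Comp C Z (Prod C A B) A (Pr1 C A B) (tuple C Z A B f g) = f \<and>
    Comp C Z (Prod C A B) B (Pr2 C A B) (tuple C Z A B f g) = g"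
  unfolding tuple_def
  by (rule theI') (use Prod_product[of A B] assms in \<open>auto simp: is_product_def\<close>)

text \<open>Joint monicity of the projections: both arrows mediate the cone formed by the components
  of \<open>k\<close>.\<close>

lemma Hom_Prod_eqI:
  assumes "Z \<in> Ob C" "A \<in> Ob C" "B \<in> Ob C"
    and h: "h \<in> Hom C Z (Prod C A B)" "k \<in> Hom C Z (Prod C A B)"
    and "Comp C Z (Prod C A B) A (Pr1 C A B) h = Comp C Z (Prod C A B) A (Pr1 C A B) k"
    and "Comp C Z (Prod C A B) B (Pr2 C A B) h = Comp C Z (Prod C A B) B (Pr2 C A B) k"
  shows "h = k"
proof -
  let ?f = "Comp C Z (Prod C A B) A (Pr1 C A B) k" and ?g = "Comp C Z (Prod C A B) B (Pr2 C A B) k"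
  have "?f \<in> Hom C Z A" "?g \<in> Hom C Z B"
    using assms Comp_in_Hom Prod_in_Ob Pr1_in_Hom Pr2_in_Hom by auto
  then have "\<exists>!h. h \<in> Hom C Z (Prod C A B) \<and>
      Comp C Z (Prod C A B) A (Pr1 C A B) h = ?f \<and> Comp C Z (Prod C A B) B (Pr2 C A B) h = ?g"
    using Prod_product[of A B] assms(1-3) unfolding is_product_def by blast
  then show ?thesis
    using assms by blast
qed

end

section \<open>Coextensions and Kleisli composition\<close>

locale pointed_fp_category = fp_category C for C :: "('o, 'a) fp_cat_data" +
  fixes X :: 'o
  assumes X_in_Ob: "X \<in> Ob C"
begin

text \<open>The coextension \<open>\<langle>pr\<^sub>1, g\<rangle> : X \<times> A \<rightarrow> X \<times> B\<close> of the comonad \<open>X \<times> -\<close>.\<close>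

abbreviation coext :: "'o \<Rightarrow> 'o \<Rightarrow> 'a \<Rightarrow> 'a" where
  "coext A B g \<equiv> tuple C (Prod C X A) X B (Pr1 C X A) g"

lemma kleisli_cat_simps [simp]:
  "Ob (kleisli_cat C X) = Ob C"
  "Hom (kleisli_cat C X) A B = Hom C (Prod C X A) B"
  "Ident (kleisli_cat C X) A = Pr2 C X A"
  "Comp (kleisli_cat C X) A B D h g = Comp C (Prod C X A) (Prod C X B) D h (coext A B g)"
  "One (kleisli_cat C X) = One C"
  "Prod (kleisli_cat C X) = Prod C"
  "Pr1 (kleisli_cat C X) A B =
    Comp C (Prod C X (Prod C A B)) (Prod C A B) A (Pr1 C A B) (Pr2 C X (Prod C A B))"
  "Pr2 (kleisli_cat C X) A B =
    Comp C (Prod C X (Prod C A B)) (Prod C A B) B (Pr2 C A B) (Pr2 C X (Prod C A B))"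
  by (simp_all add: kleisli_cat_def)

lemma
  assumes "A \<in> Ob C"
  shows XProd_in_Ob: "Prod C X A \<in> Ob C"
    and XPr1_in_Hom: "Pr1 C X A \<in> Hom C (Prod C X A) X"
    and XPr2_in_Hom: "Pr2 C X A \<in> Hom C (Prod C X A) A"
  using assms X_in_Ob Prod_in_Ob Pr1_in_Hom Pr2_in_Hom by auto

lemma
  assumes "A \<in> Ob C" "B \<in> Ob C" "g \<in> Hom C (Prod C X A) B"
  shows coext_in_Hom: "coext A B g \<in> Hom C (Prod C X A) (Prod C X B)"
    and Pr1_coext: "Comp C (Prod C X A) (Prod C X B) X (Pr1 C X B) (coext A B g) = Pr1 C X A"
    and Pr2_coext: "Comp C (Prod C X A) (Prod C X B) B (Pr2 C X B) (coext A B g) = g"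
  using tuple_properties[of "Prod C X A" X B "Pr1 C X A" g] assms X_in_Ob XProd_in_Ob XPr1_in_Hom
  by auto

lemma coext_Pr2:
  assumes "A \<in> Ob C"
  shows "coext A A (Pr2 C X A) = Ident C (Prod C X A)"
  by (rule Hom_Prod_eqI[of "Prod C X A" X A])
    (use assms in \<open>simp_all add: X_in_Ob XProd_in_Ob XPr1_in_Hom XPr2_in_Hom coext_in_Hom
      Pr1_coext Pr2_coext Ident_in_Hom Comp_Ident_right\<close>)

text \<open>With \<open>coext_Pr2\<close>, this makes coextension a functor from the Kleisli
  category to \<open>C\<close>. Associativity of Kleisli composition and functoriality of Kleisli
  reindexing both reduce to it. The proof compares the two projections.\<close>

lemma coext_Comp_coext:
  assumes "A \<in> Ob C" "B \<in> Ob C" "D \<in> Ob C"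
    and "g \<in> Hom C (Prod C X A) B" "h \<in> Hom C (Prod C X B) D"
  shows "coext A D (Comp C (Prod C X A) (Prod C X B) D h (coext A B g)) =
    Comp C (Prod C X A) (Prod C X B) (Prod C X D) (coext B D h) (coext A B g)"
proof (rule Hom_Prod_eqI[of "Prod C X A" X D])
  note obs = XProd_in_Ob[OF assms(1)] XProd_in_Ob[OF assms(2)] XProd_in_Ob[OF assms(3)]
  note homs = coext_in_Hom[OF assms(1,2,4)] coext_in_Hom[OF assms(2,3,5)]
  have hg: "Comp C (Prod C X A) (Prod C X B) D h (coext A B g) \<in> Hom C (Prod C X A) D"
    using assms obs homs by (auto intro: Comp_in_Hom)
  show "coext A D (Comp C (Prod C X A) (Prod C X B) D h (coext A B g)) \<in>
      Hom C (Prod C X A) (Prod C X D)"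
    using assms hg by (simp add: coext_in_Hom)
  show "Comp C (Prod C X A) (Prod C X B) (Prod C X D) (coext B D h) (coext A B g) \<in>
      Hom C (Prod C X A) (Prod C X D)"
    using obs homs by (auto intro: Comp_in_Hom)
  show "Comp C (Prod C X A) (Prod C X D) X (Pr1 C X D)
      (coext A D (Comp C (Prod C X A) (Prod C X B) D h (coext A B g))) =
    Comp C (Prod C X A) (Prod C X D) X (Pr1 C X D)
      (Comp C (Prod C X A) (Prod C X B) (Prod C X D) (coext B D h) (coext A B g))"
    using Comp_assoc[OF obs X_in_Ob homs XPr1_in_Hom] assms hg by (simp add: Pr1_coext)
  show "Comp C (Prod C X A) (Prod C X D) D (Pr2 C X D)
      (coext A D (Comp C (Prod C X A) (Prod C X B) D h (coext A B g))) =
    Comp C (Prod C X A) (Prod C X D) D (Pr2 C X D)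
      (Comp C (Prod C X A) (Prod C X B) (Prod C X D) (coext B D h) (coext A B g))"
    using Comp_assoc[OF obs assms(3) homs XPr2_in_Hom] assms hg by (simp add: Pr2_coext)
qed (use assms X_in_Ob XProd_in_Ob in auto)

lemma kleisli_category: "category (kleisli_cat C X)"
proof
  fix A B D E f g h
  assume obs: "A \<in> Ob (kleisli_cat C X)" "B \<in> Ob (kleisli_cat C X)"
      "D \<in> Ob (kleisli_cat C X)" "E \<in> Ob (kleisli_cat C X)"
    and homs: "f \<in> Hom (kleisli_cat C X) A B" "g \<in> Hom (kleisli_cat C X) B D"
      "h \<in> Hom (kleisli_cat C X) D E"
  then show "Comp (kleisli_cat C X) A D E h (Comp (kleisli_cat C X) A B D g f) =
      Comp (kleisli_cat C X) A B E (Comp (kleisli_cat C X) B D E h g) f"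
    by (simp add: coext_Comp_coext Comp_assoc coext_in_Hom XProd_in_Ob)
qed (auto simp: XPr2_in_Hom XProd_in_Ob coext_in_Hom coext_Pr2 Pr2_coext Comp_Ident_right
      intro: Comp_in_Hom)

section \<open>The canonical functor and product diagrams\<close>

abbreviation lift :: "'o \<Rightarrow> 'o \<Rightarrow> 'a \<Rightarrow> 'a" where
  "lift A B f \<equiv> Comp C (Prod C X A) A B f (Pr2 C X A)"

lemma lift_in_Hom:
  assumes "A \<in> Ob C" "B \<in> Ob C" "f \<in> Hom C A B"
  shows "lift A B f \<in> Hom C (Prod C X A) B"
  using assms by (auto intro!: Comp_in_Hom simp: XProd_in_Ob XPr2_in_Hom)

text \<open>Associativity together with \<open>Pr2_coext\<close>. Kleisli composition after a lifted
  arrow is thus plain composition in \<open>C\<close>, which transfers product diagrams and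
  functoriality.\<close>

lemma lift_Comp_coext:
  assumes "Z \<in> Ob C" "A \<in> Ob C" "B \<in> Ob C" "h \<in> Hom C (Prod C X Z) A" "f \<in> Hom C A B"
  shows "Comp C (Prod C X Z) (Prod C X A) B (lift A B f) (coext Z A h) =
    Comp C (Prod C X Z) A B f h"
  using assms Comp_assoc[of "Prod C X Z" "Prod C X A" A B "coext Z A h" "Pr2 C X A" f]
  by (simp add: XProd_in_Ob XPr2_in_Hom coext_in_Hom Pr2_coext)

text \<open>Kleisli arrows from \<open>A\<close> to \<open>T\<close> are arrows of \<open>C\<close>
  from \<open>Prod C X A\<close> to \<open>T\<close>.\<close>

lemma kleisli_is_terminal:
  assumes "is_terminal C T"
  shows "is_terminal (kleisli_cat C X) T"
  using assms by (simp add: is_terminal_def XProd_in_Ob)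

text \<open>The universal property at \<open>Z\<close> in the Kleisli category is that of
  \<open>Q\<close> at \<open>Prod C X Z\<close> in \<open>C\<close>. Arbitrary diagrams are treated
  because \<open>fp_functor\<close> demands preservation of all of them.\<close>

lemma kleisli_is_product:
  assumes "A \<in> Ob C" "B \<in> Ob C" "is_product C A B Q p q"
  shows "is_product (kleisli_cat C X) A B Q (lift Q A p) (lift Q B q)"
proof -
  have Q: "Q \<in> Ob C" "p \<in> Hom C Q A" "q \<in> Hom C Q B"
    using assms(3) unfolding is_product_def by blast+
  have univ: "\<exists>!h. h \<in> Hom C Z Q \<and> Comp C Z Q A p h = f \<and> Comp C Z Q B q h = g"
      if "Z \<in> Ob C" "f \<in> Hom C Z A" "g \<in> Hom C Z B" for Z f g
    using assms(3) that unfolding is_product_def by blast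
  have "\<exists>!h. h \<in> Hom C (Prod C X Z) Q \<and>
      Comp C (Prod C X Z) (Prod C X Q) A (lift Q A p) (coext Z Q h) = f \<and>
      Comp C (Prod C X Z) (Prod C X Q) B (lift Q B q) (coext Z Q h) = g"
    if "Z \<in> Ob C" "f \<in> Hom C (Prod C X Z) A" "g \<in> Hom C (Prod C X Z) B" for Z f g
    using univ[OF XProd_in_Ob[OF that(1)] that(2,3)] lift_Comp_coext[OF that(1) Q(1) assms(1) _ Q(2)]
      lift_Comp_coext[OF that(1) Q(1) assms(2) _ Q(3)]
    \<comment> \<open>Rewriting with \<open>lift_Comp_coext\<close> needs \<open>h\<close> in its
      hom-set, which \<open>conj_cong\<close> extracts from the first conjunct.\<close>
    by (simp cong: conj_cong)
  then show ?thesis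
    unfolding is_product_def using assms(1,2) Q by (simp add: lift_in_Hom)
qed

lemma kleisli_fp_category: "fp_category (kleisli_cat C X)"
proof -
  interpret K: category "kleisli_cat C X" by (rule kleisli_category)
  show ?thesis
  proof
    show "is_terminal (kleisli_cat C X) (One (kleisli_cat C X))"
      using kleisli_is_terminal[OF One_terminal] by simp
    fix A B assume "A \<in> Ob (kleisli_cat C X)" "B \<in> Ob (kleisli_cat C X)"
    then show "is_product (kleisli_cat C X) A B (Prod (kleisli_cat C X) A B)
        (Pr1 (kleisli_cat C X) A B) (Pr2 (kleisli_cat C X) A B)"
      \<comment> \<open>The projections chosen in \<open>kleisli_cat\<close> are exactly the lifts
        of those chosen in \<open>C\<close>.\<close>
      using kleisli_is_product[OF _ _ Prod_product] by simp
  qed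
qed

lemma lift_fp_functor: "fp_functor C (kleisli_cat C X) (\<lambda>A. A) lift"
proof -
  interpret K: fp_category "kleisli_cat C X" by (rule kleisli_fp_category)
  show ?thesis
  proof
    fix A B E f g
    assume *: "A \<in> Ob C" "B \<in> Ob C" "E \<in> Ob C" "f \<in> Hom C A B" "g \<in> Hom C B E"
    then show "lift A E (Comp C A B E g f) =
        Comp (kleisli_cat C X) A B E (lift B E g) (lift A B f)"
      by (simp add: lift_Comp_coext lift_in_Hom Comp_assoc XProd_in_Ob XPr2_in_Hom)
  qed (simp_all add: lift_in_Hom Comp_Ident_left XProd_in_Ob XPr2_in_Hom kleisli_is_terminal
      kleisli_is_product)
qed

end

section \<open>The Kleisli doctrine\<close>

locale kleisli_setting = implicational_doctrine P for P :: "('o, 'a, 'p) doctrine_data" +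
  fixes X :: 'o and \<phi> :: 'p
  assumes X: "X \<in> Ob (base P)" and \<phi>: "\<phi> \<in> carrier (fib P X)"
begin

sublocale pointed_fp_category "base P" X
  using base_fp_category X
  by (simp add: pointed_fp_category_def pointed_fp_category_axioms_def)

abbreviation bound :: "'o \<Rightarrow> 'p" where
  "bound A \<equiv> reindex P (Prod (base P) X A) X (Pr1 (base P) X A) \<phi>"

abbreviation KP :: "('o, 'a, 'p) doctrine_data" where
  "KP \<equiv> kleisli_doctrine P X \<phi>"

lemma kleisli_doctrine_simps [simp]:
  "base KP = kleisli_cat (base P) X"
  "fib KP A = downset (fib P (Prod (base P) X A)) (bound A)"
  "reindex KP A B g = reindex P (Prod (base P) X A) (Prod (base P) X B) (coext A B g)"
  by (simp_all add: kleisli_doctrine_def downset_def Let_def)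

lemma bound_closed:
  assumes "A \<in> Ob (base P)"
  shows "bound A \<in> carrier (fib P (Prod (base P) X A))"
  using assms reindex_closed[OF XProd_in_Ob X XPr1_in_Hom] \<phi> by auto

text \<open>Functoriality of \<open>reindex\<close> applied to \<open>Pr1_coext\<close>. It supplies
  the hypothesis \<open>h u = v\<close> of the restriction lemmas.\<close>

lemma reindex_coext_bound:
  assumes "A \<in> Ob (base P)" "B \<in> Ob (base P)" "g \<in> Hom (base P) (Prod (base P) X A) B"
  shows "reindex P (Prod (base P) X A) (Prod (base P) X B) (coext A B g) (bound B) = bound A"
  using assms X \<phi> reindex_Comp[OF XProd_in_Ob XProd_in_Ob X coext_in_Hom XPr1_in_Hom]
  by (metis Pr1_coext)

lemma kleisli_implicational_doctrine: "implicational_doctrine KP"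
proof (intro implicational_doctrine.intro primary_doctrine.intro doctrine.intro
    primary_doctrine_axioms.intro implicational_doctrine_axioms.intro)
  show "fp_category (base KP)"
    by (simp add: kleisli_fp_category)
next
  fix A assume "A \<in> Ob (base KP)"
  then have A: "A \<in> Ob (base P)" by simp
  have XA: "Prod (base P) X A \<in> Ob (base P)" using A by (rule XProd_in_Ob)
  show "partial_order (fib KP A)"
    using finite_meet_poset.downset_partial_order[OF fib_finite_meets[OF XA]] by simp
  show "finite_meet_poset (fib KP A)"
    using finite_meet_poset.downset_finite_meet_poset[OF fib_finite_meets[OF XA]] bound_closed[OF A]
    by simp
  show "cartesian_closed_poset (fib KP A)"
    using cartesian_closed_poset.downset_cartesian_closed_poset[OF fib_cartesian_closed[OF XA]]
      bound_closed[OF A] by simp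
  fix \<alpha> assume "\<alpha> \<in> carrier (fib KP A)"
  then show "reindex KP A A (Ident (base KP) A) \<alpha> = \<alpha>"
    using A XA by (simp add: coext_Pr2 reindex_Ident)
next
  fix A B g assume "A \<in> Ob (base KP)" "B \<in> Ob (base KP)" "g \<in> Hom (base KP) A B"
  then have *: "A \<in> Ob (base P)" "B \<in> Ob (base P)" "g \<in> Hom (base P) (Prod (base P) X A) B"
    by simp_all
  note arr = XProd_in_Ob[OF *(1)] XProd_in_Ob[OF *(2)] coext_in_Hom[OF *]
  note restr = reindex_isotone[OF arr] reindex_closed[OF arr]
  \<comment> \<open>Reindexing is contravariant: in the restriction lemmas \<open>u\<close> is the
    bound over \<open>B\<close> and \<open>v\<close> the bound over \<open>A\<close>.\<close>
  note bounds = bound_closed[OF *(2)] reindex_coext_bound[OF *]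
  show "reindex KP A B g \<in> carrier (fib KP B) \<rightarrow> carrier (fib KP A)"
    using downset_closed[OF restr bounds] by simp
  show "isotone (fib KP B) (fib KP A) (reindex KP A B g)"
    using isotone_downset[OF restr(1) fib_finite_meets[OF arr(2)] fib_finite_meets[OF arr(1)]]
    by simp
  show "preserves_meets (fib KP B) (fib KP A) (reindex KP A B g)"
    using preserves_meets_downset[OF fib_finite_meets[OF arr(2)] fib_finite_meets[OF arr(1)]
        restr reindex_meets[OF arr] bounds]
    by simp
  show "preserves_imp (fib KP B) (fib KP A) (reindex KP A B g)"
    using preserves_imp_downset[OF fib_cartesian_closed[OF arr(2)] fib_cartesian_closed[OF arr(1)]
        restr reindex_meets[OF arr] reindex_imp[OF arr] bounds]
    by simp
next
  fix A B D f g \<alpha>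
  assume "A \<in> Ob (base KP)" "B \<in> Ob (base KP)" "D \<in> Ob (base KP)"
    "f \<in> Hom (base KP) A B" "g \<in> Hom (base KP) B D" "\<alpha> \<in> carrier (fib KP D)"
  then show "reindex KP A D (Comp (base KP) A B D g f) \<alpha> =
      reindex KP A B f (reindex KP B D g \<alpha>)"
    by (simp add: coext_Comp_coext reindex_Comp XProd_in_Ob coext_in_Hom)
qed

section \<open>The canonical 1-arrow\<close>

lemma kleisli_map_simps [simp]:
  "on_ob (kleisli_map P X \<phi>) = (\<lambda>A. A)"
  "on_arr (kleisli_map P X \<phi>) = lift"
  "on_fib (kleisli_map P X \<phi>) A = (\<lambda>\<alpha>. bound A \<sqinter>\<^bsub>fib P (Prod (base P) X A)\<^esub>
    reindex P (Prod (base P) X A) A (Pr2 (base P) X A) \<alpha>)"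
  by (simp_all add: kleisli_map_def Let_def)

text \<open>Reindexing along the coextension preserves the meet and carries bound to bound, leaving
  the second factors. By \<open>Pr2_coext\<close> both of these are \<open>\<beta>\<close> reindexed
  along \<open>lift A B f\<close>.\<close>

lemma kleisli_map_natural:
  assumes AB: "A \<in> Ob (base P)" "B \<in> Ob (base P)" and f: "f \<in> Hom (base P) A B"
    and \<beta>: "\<beta> \<in> carrier (fib P B)"
  shows "on_fib (kleisli_map P X \<phi>) A (reindex P A B f \<beta>) =
    reindex KP A B (lift A B f) (on_fib (kleisli_map P X \<phi>) B \<beta>)"
proof -
  let ?r = "reindex P (Prod (base P) X A) (Prod (base P) X B) (coext A B (lift A B f))"
  let ?\<beta> = "reindex P (Prod (base P) X B) B (Pr2 (base P) X B) \<beta>"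
  note lf = lift_in_Hom[OF AB f]
  note obs = XProd_in_Ob[OF AB(1)] XProd_in_Ob[OF AB(2)]
  have "?\<beta> \<in> carrier (fib P (Prod (base P) X B))"
    using reindex_closed[OF obs(2) AB(2) XPr2_in_Hom[OF AB(2)]] \<beta> by auto
  then have "?r (bound B \<sqinter>\<^bsub>fib P (Prod (base P) X B)\<^esub> ?\<beta>) =
      bound A \<sqinter>\<^bsub>fib P (Prod (base P) X A)\<^esub> ?r ?\<beta>"
    using reindex_meets[OF obs coext_in_Hom[OF AB lf]] bound_closed[OF AB(2)]
    by (simp add: preserves_meets_def reindex_coext_bound[OF AB lf])
  moreover have "?r ?\<beta> = reindex P (Prod (base P) X A) B (lift A B f) \<beta>"
    using reindex_Comp[OF obs AB(2) coext_in_Hom[OF AB lf] XPr2_in_Hom[OF AB(2)] \<beta>]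
    by (simp add: Pr2_coext[OF AB lf])
  moreover have "\<dots> = reindex P (Prod (base P) X A) A (Pr2 (base P) X A) (reindex P A B f \<beta>)"
    using reindex_Comp[OF obs(1) AB XPr2_in_Hom[OF AB(1)] f \<beta>] .
  ultimately show ?thesis by simp
qed

text \<open>Each fibre map factors as reindexing along \<open>Pr2\<close> followed by meeting with
  the bound. The first factor preserves the structure since \<open>P\<close> is implicational, the
  second by the lemmas on meeting with a fixed element.\<close>

lemma kleisli_implicational_hom: "implicational_hom P KP (kleisli_map P X \<phi>)"
proof -
  interpret K: implicational_doctrine KP by (rule kleisli_implicational_doctrine)
  show ?thesis
  proof (intro implicational_hom.intro doctrine_hom.intro doctrine_hom_axioms.intro
      implicational_hom_axioms.intro doctrine_axioms K.doctrine_axioms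
      implicational_doctrine_axioms K.implicational_doctrine_axioms)
    show "fp_functor (base P) (base KP) (on_ob (kleisli_map P X \<phi>)) (on_arr (kleisli_map P X \<phi>))"
      using lift_fp_functor by simp
  next
    fix A assume A: "A \<in> Ob (base P)"
    note arr = XProd_in_Ob[OF A] A XPr2_in_Hom[OF A]
    note u = bound_closed[OF A]
    interpret F: cartesian_closed_poset "fib P (Prod (base P) X A)"
      by (rule fib_cartesian_closed[OF arr(1)])
    \<comment> \<open>The interpretations \<open>D\<close> and \<open>G\<close> provide the weak
      partial orders that \<open>isotone\<close> includes.\<close>
    interpret D: partial_order "fib KP A"
      using A by (intro K.fib_partial_order) simp
    interpret G: partial_order "fib P A"
      by (rule fib_partial_order[OF A])
    show "on_fib (kleisli_map P X \<phi>) A \<in>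
        carrier (fib P A) \<rightarrow> carrier (fib KP (on_ob (kleisli_map P X \<phi>) A))"
      using reindex_closed[OF arr] u by (auto intro!: F.meet_closed F.meet_left)
    show "preserves_meets (fib P A) (fib KP (on_ob (kleisli_map P X \<phi>) A))
        (on_fib (kleisli_map P X \<phi>) A)"
      using preserves_meets_compose[OF reindex_meets[OF arr] meet_preserves_meets[OF fib_finite_meets[OF arr(1)] u]
          reindex_closed[OF arr]] by simp
    show "preserves_imp (fib P A) (fib KP (on_ob (kleisli_map P X \<phi>) A))
        (on_fib (kleisli_map P X \<phi>) A)"
      using preserves_imp_compose[OF reindex_imp[OF arr] F.meet_preserves_imp[OF u]
          reindex_closed[OF arr]] by simp
    have "on_fib (kleisli_map P X \<phi>) A a \<sqsubseteq>\<^bsub>fib P (Prod (base P) X A)\<^esub>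
        on_fib (kleisli_map P X \<phi>) A b"
      if ab: "a \<in> carrier (fib P A)" "b \<in> carrier (fib P A)" "a \<sqsubseteq>\<^bsub>fib P A\<^esub> b" for a b
    proof -
      let ?r = "reindex P (Prod (base P) X A) A (Pr2 (base P) X A)"
      have "?r a \<in> carrier (fib P (Prod (base P) X A))" "?r b \<in> carrier (fib P (Prod (base P) X A))"
        using reindex_closed[OF arr] ab by auto
      moreover have "?r a \<sqsubseteq>\<^bsub>fib P (Prod (base P) X A)\<^esub> ?r b"
        using reindex_isotone[OF arr] ab by (auto simp: isotone_def)
      ultimately show ?thesis
        using u by (simp add: F.le_meet_iff F.meet_left_le F.meet_right_le)
    qed
    then show "isotone (fib P A) (fib KP (on_ob (kleisli_map P X \<phi>) A))
        (on_fib (kleisli_map P X \<phi>) A)"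
      using D.weak_partial_order_axioms G.weak_partial_order_axioms by (simp add: isotone_def)
  next
    fix A B f \<beta>
    assume "A \<in> Ob (base P)" "B \<in> Ob (base P)" "f \<in> Hom (base P) A B" "\<beta> \<in> carrier (fib P B)"
    then show "on_fib (kleisli_map P X \<phi>) A (reindex P A B f \<beta>) =
        reindex KP (on_ob (kleisli_map P X \<phi>) A) (on_ob (kleisli_map P X \<phi>) B)
          (on_arr (kleisli_map P X \<phi>) A B f) (on_fib (kleisli_map P X \<phi>) B \<beta>)"
      using kleisli_map_natural[of A B f \<beta>] by simp
  qed
qed

end

theorem proposition5p7:
  fixes P :: "('o, 'a, 'p) doctrine_data" and X :: 'o and \<phi> :: 'p
  assumes "primary_doctrine P"
    and "X \<in> Ob (base P)"
    and "\<phi> \<in> carrier (fib P X)"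
    and "implicational_doctrine P"
  shows "implicational_doctrine (kleisli_doctrine P X \<phi>) \<and>
    implicational_hom P (kleisli_doctrine P X \<phi>) (kleisli_map P X \<phi>)"
proof -
  interpret kleisli_setting P X \<phi>
    using assms by (simp add: kleisli_setting_def kleisli_setting_axioms_def)
  show ?thesis
    using kleisli_implicational_doctrine kleisli_implicational_hom ..
qed

end
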